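(* There is a set $A\subseteq\omega$ which is $0$-weakly stochastic but not $0$-Church stochastic.
   Context: For $A\subseteq\omega$, the density of $A$ at $n$ is $\rho_n(A)=|A\cap\{0,\dots,n-1\}|/n$, and $\rho(A)$ denotes $\lim_n\rho_n(A)$ when it exists ($\overline{\rho}$ is the $\limsup$). A skip sequence is an element $\sigma$ of $(\omega\times 2)^{<\omega}$ whose first coordinates are strictly increasing; $\sigma(k)_0$ is the first coordinate of the $k$-th entry, $\sigma(k)_1$ the second. Let $S$ be the set of skip sequences. A skip rule is a total function $f:S\to\omega$ with $f(\sigma)>\sigma(|\sigma|-1)_0$ for all $\sigma\in S$. Given $A$, the selected sequence $f(A)$ is defined recursively by $\chi_{f(A)}(0)=A(f(\emptyset))$ and $\chi_{f(A)}(n+1)=A(f(f(A)\upharpoonright n+1))$, where $f(A)\upharpoonright n+1$ is read as the skip sequence of the doors selected so far paired with their bits. $A$ is $\alpha$-weakly stochastic if $\rho(f(A))=\alpha$ for every computable skip rule $f$ (i.e. orderly, adaptive selection where every examined bit must be selected). $A$ is $\alpha$-Church stochastic if for every total computable selection strategy that scans the bits of $A$ in the original order and, using the previously scanned bits, computably decides whether to select the next bit (bits may be scanned without being selected), the selected subsequence, if infinite, has density $\alpha$. *)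

theory Defs
  imports Complex_Main "HOL-Library.Nat_Bijection" "HOL-Library.Infinite_Set"
begin

section \<open>Partial recursive functions\<close>

datatype recf =
    Zero
  | Succ
  | Proj nat
  | Comp recf "recf list"
  | PrimRec recf recf
  | Mu recf

text \<open>
  The recursion argument of \<^term>\<open>PrimRec f g\<close> and the search argument of \<^term>\<open>Mu f\<close> come first
  in the argument list. \<^term>\<open>Mu f\<close> is Kleene's minimization: it converges with value \<open>n\<close> iff \<open>f\<close>
  converges to 0 at \<open>n\<close> and converges to a nonzero value at every smaller argument. The value
  \<^term>\<open>None\<close> stands for divergence or a wrong number of arguments.
\<close>

fun recf_eval :: "recf \<Rightarrow> nat list \<Rightarrow> nat option" where
  "recf_eval Zero xs = Some 0"
| "recf_eval Succ xs = (case xs of [x] \<Rightarrow> Some (Suc x) | _ \<Rightarrow> None)"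
| "recf_eval (Proj i) xs = (if i < length xs then Some (xs ! i) else None)"
| "recf_eval (Comp f gs) xs =
    (if \<forall>g \<in> set gs. recf_eval g xs \<noteq> None
     then recf_eval f (map (\<lambda>g. the (recf_eval g xs)) gs) else None)"
| "recf_eval (PrimRec f g) xs =
    (case xs of
       [] \<Rightarrow> None
     | n # ys \<Rightarrow>
         rec_nat (recf_eval f ys) (\<lambda>k r. Option.bind r (\<lambda>y. recf_eval g (k # y # ys))) n)"
| "recf_eval (Mu f) xs =
    (if \<exists>n. recf_eval f (n # xs) = Some 0 \<and> (\<forall>k<n. \<exists>y. recf_eval f (k # xs) = Some (Suc y))
     then Some (LEAST n. recf_eval f (n # xs) = Some 0) else None)"

text \<open>
  Computability of a function on a set \<open>D\<close> of finite objects, relative to an injective coding \<open>enc\<close>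
  of these objects by natural numbers. Nothing is required of the computation outside \<open>D\<close>.
\<close>

definition computable_on :: "('a \<Rightarrow> nat) \<Rightarrow> 'a set \<Rightarrow> ('a \<Rightarrow> nat) \<Rightarrow> bool" where
  "computable_on enc D f \<longleftrightarrow> (\<exists>r. \<forall>x\<in>D. recf_eval r [enc x] = Some (f x))"

section \<open>Density\<close>

definition density_at :: "nat \<Rightarrow> nat set \<Rightarrow> real" where
  "density_at n A = real (card (A \<inter> {..<n})) / real n"

definition has_density :: "nat set \<Rightarrow> real \<Rightarrow> bool" where
  "has_density A \<alpha> \<longleftrightarrow> (\<lambda>n. density_at n A) \<longlonglongrightarrow> \<alpha>"

section \<open>Weak stochasticity\<close>

definition skip_sequences :: "(nat \<times> bool) list set" where
  "skip_sequences = {\<sigma>. sorted_wrt (<) (map fst \<sigma>)}"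

text \<open>
  A skip rule is a function on \<^const>\<open>skip_sequences\<close>; its values elsewhere are never used.
  There is no constraint on its value at the empty sequence.
\<close>

definition skip_rule :: "((nat \<times> bool) list \<Rightarrow> nat) \<Rightarrow> bool" where
  "skip_rule f \<longleftrightarrow> (\<forall>\<sigma> \<in> skip_sequences. \<sigma> \<noteq> [] \<longrightarrow> f \<sigma> > fst (last \<sigma>))"

definition skip_code :: "(nat \<times> bool) list \<Rightarrow> nat" where
  "skip_code \<sigma> = list_encode (map (\<lambda>(n, b). prod_encode (n, of_bool b)) \<sigma>)"

primrec skip_history :: "((nat \<times> bool) list \<Rightarrow> nat) \<Rightarrow> nat set \<Rightarrow> nat \<Rightarrow> (nat \<times> bool) list" where
  "skip_history f A 0 = []"
| "skip_history f A (Suc n) =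
    skip_history f A n @ [(f (skip_history f A n), f (skip_history f A n) \<in> A)]"

definition skip_select :: "((nat \<times> bool) list \<Rightarrow> nat) \<Rightarrow> nat set \<Rightarrow> nat set" where
  "skip_select f A = {n. f (skip_history f A n) \<in> A}"

lemma skip_history_in_skip_sequences:
  assumes "skip_rule f"
  shows "skip_history f A n \<in> skip_sequences"
proof (induction n)
  case 0
  then show ?case by (simp add: skip_sequences_def)
next
  case (Suc n)
  let ?s = "skip_history f A n"
  have "fst p < f ?s" if "p \<in> set ?s" for p
  proof -
    from that have ne: "?s \<noteq> []" by auto
    then have eq: "?s = butlast ?s @ [last ?s]" by simp
    have "sorted_wrt (<) (map fst (butlast ?s @ [last ?s]))"
      using Suc.IH eq by (simp add: skip_sequences_def)
    then have "\<forall>q \<in> set (butlast ?s). fst q < fst (last ?s)"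
      by (simp add: sorted_wrt_append)
    moreover have "p \<in> set (butlast ?s) \<or> p = last ?s"
      using that eq by (metis Un_iff empty_iff insert_iff list.set set_append)
    moreover have "fst (last ?s) < f ?s"
      using assms Suc.IH ne by (simp add: skip_rule_def)
    ultimately show ?thesis by auto
  qed
  then show ?case using Suc.IH
    by (auto simp: skip_sequences_def sorted_wrt_append)
qed

definition weakly_stochastic :: "real \<Rightarrow> nat set \<Rightarrow> bool" where
  "weakly_stochastic \<alpha> A \<longleftrightarrow>
    (\<forall>f. skip_rule f \<and> computable_on skip_code skip_sequences f
      \<longrightarrow> has_density (skip_select f A) \<alpha>)"

section \<open>Church stochasticity\<close>

text \<open>
  A selection strategy \<open>s\<close> maps the list of the first \<open>n\<close> bits of \<open>A\<close> to the decision whether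
  bit \<open>n\<close> is to be selected.
\<close>

definition bits_code :: "bool list \<Rightarrow> nat" where
  "bits_code w = list_encode (map of_bool w)"

definition initial_bits :: "nat set \<Rightarrow> nat \<Rightarrow> bool list" where
  "initial_bits A n = map (\<lambda>i. i \<in> A) [0..<n]"

definition selected_positions :: "(bool list \<Rightarrow> bool) \<Rightarrow> nat set \<Rightarrow> nat set" where
  "selected_positions s A = {n. s (initial_bits A n)}"

definition selected_subsequence :: "(bool list \<Rightarrow> bool) \<Rightarrow> nat set \<Rightarrow> nat set" where
  "selected_subsequence s A = {k. Infinite_Set.enumerate (selected_positions s A) k \<in> A}"

definition church_stochastic :: "real \<Rightarrow> nat set \<Rightarrow> bool" where
  "church_stochastic \<alpha> A \<longleftrightarrow>
    (\<forall>s. computable_on bits_code UNIV (\<lambda>w. of_bool (s w)) \<and> infinite (selected_positions s A)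
      \<longrightarrow> has_density (selected_subsequence s A) \<alpha>)"

end

theory Submission
  imports Defs "HOL-Library.Countable" "HOL-Real_Asymp.Real_Asymp"
begin

text \<open>
  Along any set, the position a fixed skip rule examines in step \<open>n\<close> takes only finitely many
  values, one for each string of bits seen so far. As there are only countably many computable
  skip rules, some strictly increasing \<open>a\<close> is such that each of them, whatever bits it sees, for
  almost all \<open>j\<close> examines in its first \<open>j\<^sup>2\<close> steps only positions below \<open>a j\<close>. Let \<open>A\<close> consist of
  the pairs \<open>2 a j, 2 a j + 1\<close>. Then a skip rule finds at most \<open>2 j\<close> elements of \<open>A\<close> in its first
  \<open>j\<^sup>2\<close> steps, so it selects a set of density \<open>0\<close>. On the other hand, the strategy which selects a
  bit iff an odd number of ones has been scanned selects exactly the second member of each pair.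
\<close>

section \<open>Total recursive functions\<close>

text \<open>With the arity \<open>k\<close> fixed, recursive functions are built by closure lemmas
  on terms over the argument list, without writing \<open>recf\<close> programs.\<close>

definition total_recursive :: "nat \<Rightarrow> (nat list \<Rightarrow> nat) \<Rightarrow> bool" where
  "total_recursive k f \<longleftrightarrow> (\<exists>r. \<forall>xs. length xs = k \<longrightarrow> recf_eval r xs = Some (f xs))"

lemma total_recursive_zero: "total_recursive k (\<lambda>_. 0)"
  unfolding total_recursive_def by (rule exI[of _ Zero]) simp

lemma total_recursive_nth: "i < k \<Longrightarrow> total_recursive k (\<lambda>xs. xs ! i)"
  unfolding total_recursive_def by (rule exI[of _ "Proj i"]) simp

lemma total_recursive_Suc:
  assumes "total_recursive k f"
  shows "total_recursive k (\<lambda>xs. Suc (f xs))"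
proof -
  from assms obtain r where "\<And>xs. length xs = k \<Longrightarrow> recf_eval r xs = Some (f xs)"
    by (auto simp: total_recursive_def)
  then show ?thesis
    unfolding total_recursive_def by (intro exI[of _ "Comp Succ [r]"]) simp
qed

lemma total_recursive_one: "total_recursive k (\<lambda>_. 1)"
  using total_recursive_Suc[OF total_recursive_zero] by simp

lemma recf_eval_Comp_eq:
  assumes "map (\<lambda>g. recf_eval g xs) gs = map Some ys"
  shows "recf_eval (Comp f gs) xs = recf_eval f ys"
proof -
  have "\<forall>g \<in> set gs. recf_eval g xs \<noteq> None"
    using arg_cong[OF assms, of set] by auto
  moreover have "map (\<lambda>g. the (recf_eval g xs)) gs = ys"
    using arg_cong[OF assms, of "map the"] by (simp add: o_def)
  ultimately show ?thesis by simp
qed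

lemma map_eval_Proj:
  assumes "length xs = m + k"
  shows "map (\<lambda>g. recf_eval g xs) (map (\<lambda>i. Proj (m + i)) [0..<k]) = map Some (drop m xs)"
  using assms by (intro nth_equalityI) auto

text \<open>A step function in \<open>total_recursive_rec\<close> finds its parameters behind the
  counter and the accumulator; projections shifted by \<open>m\<close> reach them.\<close>

lemma total_recursive_drop:
  assumes "total_recursive k f"
  shows "total_recursive (m + k) (\<lambda>xs. f (drop m xs))"
proof -
  from assms obtain r where "\<And>xs. length xs = k \<Longrightarrow> recf_eval r xs = Some (f xs)"
    by (auto simp: total_recursive_def)
  then show ?thesis
    unfolding total_recursive_def
    by (intro exI[of _ "Comp r (map (\<lambda>i. Proj (m + i)) [0..<k])"] allI impI)
      (simp only: recf_eval_Comp_eq[OF map_eval_Proj], simp)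
qed

text \<open>The number of iterations is itself computed from the arguments, so
  \<open>PrimRec\<close> is composed with \<open>rn\<close> and with projections passing the
  arguments on.\<close>

lemma total_recursive_rec:
  assumes "total_recursive k f"
    and "total_recursive (Suc (Suc k)) (\<lambda>xs. g (xs ! 0) (xs ! 1) (drop 2 xs))"
    and "total_recursive k n"
  shows "total_recursive k (\<lambda>xs. rec_nat (f xs) (\<lambda>m y. g m y xs) (n xs))"
proof -
  obtain rf where rf: "\<And>xs. length xs = k \<Longrightarrow> recf_eval rf xs = Some (f xs)"
    using assms(1) by (auto simp: total_recursive_def)
  obtain rg where "\<And>xs. length xs = Suc (Suc k) \<Longrightarrow>
      recf_eval rg xs = Some (g (xs ! 0) (xs ! 1) (drop 2 xs))"
    using assms(2) by (auto simp: total_recursive_def)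
  from this[of "_ # _ # _"]
  have rg: "recf_eval rg (m # y # xs) = Some (g m y xs)" if "length xs = k" for m y xs
    using that by simp
  obtain rn where rn: "\<And>xs. length xs = k \<Longrightarrow> recf_eval rn xs = Some (n xs)"
    using assms(3) by (auto simp: total_recursive_def)
  have rec: "rec_nat (recf_eval rf xs) (\<lambda>k r. Option.bind r (\<lambda>y. recf_eval rg (k # y # xs))) j =
      Some (rec_nat (f xs) (\<lambda>m y. g m y xs) j)" if "length xs = k" for xs j
    by (induction j) (simp_all add: rf rg that)
  show ?thesis
    unfolding total_recursive_def
  proof (intro exI[of _ "Comp (PrimRec rf rg) (rn # map (\<lambda>i. Proj (0 + i)) [0..<k])"] allI impI)
    fix xs :: "nat list"
    assume len: "length xs = k"
    have "map (\<lambda>g. recf_eval g xs) (rn # map (\<lambda>i. Proj (0 + i)) [0..<k]) = map Some (n xs # xs)"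
      using rn[OF len] map_eval_Proj[of xs 0 k] len by simp
    then have "recf_eval (Comp (PrimRec rf rg) (rn # map (\<lambda>i. Proj (0 + i)) [0..<k])) xs =
        recf_eval (PrimRec rf rg) (n xs # xs)"
      by (rule recf_eval_Comp_eq)
    also have "\<dots> = Some (rec_nat (f xs) (\<lambda>m y. g m y xs) (n xs))"
      by (simp add: rec[OF len])
    finally show "recf_eval (Comp (PrimRec rf rg) (rn # map (\<lambda>i. Proj (0 + i)) [0..<k])) xs =
        Some (rec_nat (f xs) (\<lambda>m y. g m y xs) (n xs))" .
  qed
qed

section \<open>Arithmetic as instances of primitive recursion\<close>

lemma total_recursive_pred:
  assumes "total_recursive k f"
  shows "total_recursive k (\<lambda>xs. f xs - 1)"
proof -
  have "rec_nat 0 (\<lambda>m y. m) n = n - 1" for n :: nat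
    by (cases n) auto
  then show ?thesis
    using total_recursive_rec[OF total_recursive_zero _ assms, of "\<lambda>m y xs. m"]
      total_recursive_nth[of 0 "Suc (Suc k)"] by simp
qed

lemma total_recursive_diff:
  assumes "total_recursive k f" "total_recursive k g"
  shows "total_recursive k (\<lambda>xs. f xs - g xs)"
proof -
  have "rec_nat a (\<lambda>m y. y - 1) b = a - b" for a b :: nat
    by (induction b) auto
  then show ?thesis
    using total_recursive_rec[OF assms(1) _ assms(2), of "\<lambda>m y xs. y - 1"]
      total_recursive_pred[OF total_recursive_nth[of 1 "Suc (Suc k)"]] by simp
qed

lemma total_recursive_add:
  assumes "total_recursive k f" "total_recursive k g"
  shows "total_recursive k (\<lambda>xs. f xs + g xs)"
proof -
  have "rec_nat a (\<lambda>m y. Suc y) b = a + b" for a b :: nat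
    by (induction b) auto
  then show ?thesis
    using total_recursive_rec[OF assms(1) _ assms(2), of "\<lambda>m y xs. Suc y"]
      total_recursive_Suc[OF total_recursive_nth[of 1 "Suc (Suc k)"]] by simp
qed

lemma total_recursive_triangle:
  assumes "total_recursive k f"
  shows "total_recursive k (\<lambda>xs. triangle (f xs))"
proof -
  have "rec_nat 0 (\<lambda>m y. y + Suc m) n = triangle n" for n
    by (induction n) auto
  then show ?thesis
    using total_recursive_rec[OF total_recursive_zero _ assms, of "\<lambda>m y xs. y + Suc m"]
      total_recursive_add[OF total_recursive_nth
        total_recursive_Suc[OF total_recursive_nth], of 1 "Suc (Suc k)" 0] by simp
qed

section \<open>Decoding bit lists\<close>

text \<open>The largest \<open>s\<close> with \<open>triangle s \<le> n\<close>, needed to invert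
  the pairing function. No search is required: the summand is 1 iff the truncated difference
  vanishes, that is, iff the next triangular number has been reached.\<close>

definition triangle_root :: "nat \<Rightarrow> nat" where
  "triangle_root n = rec_nat 0 (\<lambda>m y. y + (1 - (triangle (Suc y) - Suc m))) n"

lemma triangle_mono: "m \<le> n \<Longrightarrow> triangle m \<le> triangle n"
  by (induction n) (auto simp: le_Suc_eq)

lemma triangle_root_bounds:
  "triangle (triangle_root n) \<le> n \<and> n < triangle (Suc (triangle_root n))"
proof (induction n)
  case 0
  then show ?case by (simp add: triangle_root_def)
next
  case (Suc n)
  define s where "s = triangle_root n"
  have s: "triangle s \<le> n" "n < triangle (Suc s)"
    using Suc.IH by (simp_all add: s_def)
  have "triangle_root (Suc n) = s + (1 - (triangle (Suc s) - Suc n))"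
    by (simp add: triangle_root_def s_def)
  then show ?case
    using s by (cases "triangle (Suc s) = Suc n") auto
qed

lemma triangle_root_eqI:
  assumes "triangle s \<le> n" "n < triangle (Suc s)"
  shows "triangle_root n = s"
proof (rule antisym; rule ccontr)
  assume "\<not> triangle_root n \<le> s"
  then have "triangle (Suc s) \<le> triangle (triangle_root n)"
    by (intro triangle_mono) simp
  then show False
    using assms triangle_root_bounds[of n] by linarith
next
  assume "\<not> s \<le> triangle_root n"
  then have "triangle (Suc (triangle_root n)) \<le> triangle s"
    by (intro triangle_mono) simp
  then show False
    using assms triangle_root_bounds[of n] by linarith
qed

lemma total_recursive_triangle_root:
  assumes "total_recursive k f"
  shows "total_recursive k (\<lambda>xs. triangle_root (f xs))"
proof -
  have "total_recursive (Suc (Suc k))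
      (\<lambda>xs. xs ! 1 + (1 - (triangle (Suc (xs ! 1)) - Suc (xs ! 0))))"
    by (intro total_recursive_add total_recursive_diff total_recursive_one
        total_recursive_triangle total_recursive_Suc total_recursive_nth) simp_all
  then show ?thesis
    unfolding triangle_root_def
    using total_recursive_rec[OF total_recursive_zero _ assms,
        of "\<lambda>m y xs. y + (1 - (triangle (Suc y) - Suc m))"] by simp
qed

text \<open>A nonempty list has code \<open>Suc (triangle (x + c) + x)\<close>, where
  \<open>c\<close> codes its tail. So \<open>n - 1\<close> exceeds the triangular number below it by
  \<open>x\<close>, and the root is \<open>x + c\<close>.\<close>

definition code_hd :: "nat \<Rightarrow> nat" where
  "code_hd n = (n - 1) - triangle (triangle_root (n - 1))"

definition code_tl :: "nat \<Rightarrow> nat" where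
  "code_tl n = triangle_root (n - 1) - code_hd n"

lemma code_hd_tl_0 [simp]: "code_hd 0 = 0" "code_tl 0 = 0"
  by (simp_all add: code_hd_def code_tl_def triangle_root_def)

lemma code_hd_tl_Cons [simp]:
  "code_hd (list_encode (x # xs)) = x" "code_tl (list_encode (x # xs)) = list_encode xs"
proof -
  have "triangle_root (prod_encode (x, list_encode xs)) = x + list_encode xs"
    by (rule triangle_root_eqI) (auto simp: prod_encode_def)
  then show "code_hd (list_encode (x # xs)) = x" "code_tl (list_encode (x # xs)) = list_encode xs"
    by (simp_all add: code_hd_def code_tl_def) (simp_all add: prod_encode_def)
qed

lemma total_recursive_code_hd:
  "total_recursive k f \<Longrightarrow> total_recursive k (\<lambda>xs. code_hd (f xs))"
  unfolding code_hd_def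
  by (intro total_recursive_diff total_recursive_pred total_recursive_triangle
      total_recursive_triangle_root)

lemma total_recursive_code_tl:
  "total_recursive k f \<Longrightarrow> total_recursive k (\<lambda>xs. code_tl (f xs))"
  unfolding code_tl_def
  by (intro total_recursive_diff total_recursive_pred total_recursive_code_hd
      total_recursive_triangle_root)

definition code_drop :: "nat \<Rightarrow> nat \<Rightarrow> nat" where
  "code_drop i e = rec_nat e (\<lambda>m y. code_tl y) i"

lemma code_drop_list_encode: "code_drop i (list_encode xs) = list_encode (drop i xs)"
proof (induction i)
  case 0
  then show ?case by (simp add: code_drop_def)
next
  case (Suc i)
  then have "code_drop (Suc i) (list_encode xs) = code_tl (list_encode (drop i xs))"
    by (simp add: code_drop_def)
  also have "\<dots> = list_encode (tl (drop i xs))"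
    by (cases "drop i xs") (simp_all del: list_encode.simps(2))
  finally show ?case
    by (simp add: drop_Suc tl_drop)
qed

text \<open>Allows the code itself to bound the loop in \<open>code_parity\<close>, so that no
  length has to be computed.\<close>

lemma length_le_list_encode: "length xs \<le> list_encode xs"
proof (induction xs)
  case (Cons x xs)
  also have "list_encode xs \<le> prod_encode (x, list_encode xs)"
    by (rule le_prod_encode_2)
  finally show ?case by simp
qed simp

text \<open>With truncated subtraction the step is exclusive or on bits. Iterations past the end of
  the list read head 0 and leave the parity unchanged.\<close>

definition code_parity :: "nat \<Rightarrow> nat" where
  "code_parity e = rec_nat 0
    (\<lambda>m y. (y - code_hd (code_drop m e)) + (code_hd (code_drop m e) - y)) e"

lemma code_parity_bits_code: "code_parity (bits_code w) = of_bool (odd (count_list w True))"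
proof -
  have "rec_nat 0 (\<lambda>m y. (y - code_hd (code_drop m (bits_code w))) +
          (code_hd (code_drop m (bits_code w)) - y)) i =
        of_bool (odd (count_list (take i w) True))" for i
  proof (induction i)
    case (Suc i)
    show ?case
    proof (cases "i < length w")
      case True
      have "code_hd (code_drop i (bits_code w)) = of_bool (w ! i)"
        unfolding bits_code_def code_drop_list_encode
        using True by (simp add: drop_map Cons_nth_drop_Suc[symmetric] del: list_encode.simps(2))
      moreover have "take (Suc i) w = take i w @ [w ! i]"
        using True by (rule take_Suc_conv_app_nth)
      ultimately show ?thesis
        using Suc.IH by auto
    next
      case False
      then have "code_hd (code_drop i (bits_code w)) = 0"
        unfolding bits_code_def code_drop_list_encode by simp
      then show ?thesis
        using Suc.IH False by simp
    qed
  qed simp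
  moreover have "length w \<le> bits_code w"
    using length_le_list_encode[of "map of_bool w"] by (simp add: bits_code_def)
  ultimately show ?thesis
    by (simp add: code_parity_def)
qed

lemma total_recursive_code_parity: "total_recursive 1 (\<lambda>xs. code_parity (xs ! 0))"
proof -
  \<comment> \<open>The three arguments are the counter and the accumulator of the outer loop, and
    the code.\<close>
  have drop: "total_recursive 3 (\<lambda>xs. code_hd (code_drop (xs ! 0) (drop 2 xs ! 0)))"
    unfolding code_drop_def
    using total_recursive_drop[OF total_recursive_nth, of 0 1 2]
    by (intro total_recursive_code_hd total_recursive_rec total_recursive_code_tl
        total_recursive_nth) auto
  show ?thesis
    unfolding code_parity_def
    using drop by (intro total_recursive_rec total_recursive_zero total_recursive_nth
        total_recursive_add total_recursive_diff) (auto simp: numeral_3_eq_3)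
qed

lemma computable_odd_ones:
  "computable_on bits_code UNIV (\<lambda>w. of_bool (odd (count_list w True)))"
proof -
  obtain r where "\<And>xs. length xs = 1 \<Longrightarrow> recf_eval r xs = Some (code_parity (xs ! 0))"
    using total_recursive_code_parity by (auto simp: total_recursive_def)
  from this[of "[bits_code w]" for w] show ?thesis
    unfolding computable_on_def
    by (intro exI[of _ r]) (simp add: code_parity_bits_code)
qed

section \<open>Sets of adjacent pairs\<close>

definition pairs_at :: "nat set \<Rightarrow> nat set" where
  "pairs_at R = {x. x div 2 \<in> R}"

text \<open>Complete pairs contribute an even number of ones. The count below \<open>n\<close> is
  odd only when \<open>n\<close> separates the two members of a pair.\<close>

lemma odd_card_pairs_at:
  "odd (card (pairs_at R \<inter> {..<n})) \<longleftrightarrow> odd n \<and> n div 2 \<in> R"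
proof (induction n)
  case (Suc n)
  have "pairs_at R \<inter> {..<Suc n} =
      (if n div 2 \<in> R then insert n (pairs_at R \<inter> {..<n}) else pairs_at R \<inter> {..<n})"
    by (auto simp: pairs_at_def less_Suc_eq)
  then have card: "card (pairs_at R \<inter> {..<Suc n}) =
      card (pairs_at R \<inter> {..<n}) + of_bool (n div 2 \<in> R)"
    by simp
  show ?case
    unfolding card using Suc.IH by (cases "even n"; cases "n div 2 \<in> R") simp_all
qed simp

lemma count_initial_bits: "count_list (initial_bits A n) True = card (A \<inter> {..<n})"
proof (induction n)
  case (Suc n)
  have "A \<inter> {..<Suc n} = (if n \<in> A then insert n (A \<inter> {..<n}) else A \<inter> {..<n})"
    by (auto simp: less_Suc_eq)
  then show ?case
    using Suc.IH by (simp add: initial_bits_def)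
qed (simp add: initial_bits_def)

lemma pairs_at_not_church_stochastic:
  assumes "infinite R"
  shows "\<not> church_stochastic 0 (pairs_at R)"
proof
  assume church: "church_stochastic 0 (pairs_at R)"
  define s where "s w = odd (count_list w True)" for w
  define P where "P = selected_positions s (pairs_at R)"
  have P: "P = {n. odd n \<and> n div 2 \<in> R}"
    by (simp add: P_def selected_positions_def s_def count_initial_bits odd_card_pairs_at)
  have "(\<lambda>m. Suc (2 * m)) ` R \<subseteq> P"
    by (auto simp: P)
  moreover have "inj_on (\<lambda>m. Suc (2 * m)) R"
    by (auto simp: inj_on_def)
  ultimately have inf: "infinite P"
    using assms by (meson finite_imageD finite_subset)
  \<comment> \<open>Every selected bit is 1, so the selected subsequence has density 1.\<close>
  have "enumerate P k \<in> pairs_at R" for k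
    using enumerate_in_set[OF inf, of k] by (auto simp: P pairs_at_def)
  then have "selected_subsequence s (pairs_at R) = UNIV"
    by (auto simp: selected_subsequence_def P_def)
  moreover have "has_density (selected_subsequence s (pairs_at R)) 0"
    using church[unfolded church_stochastic_def, rule_format, of s] inf computable_odd_ones
    by (simp add: P_def s_def)
  ultimately have "(\<lambda>n. density_at n UNIV) \<longlonglongrightarrow> 0"
    by (simp add: has_density_def)
  moreover have "(\<lambda>n. density_at n UNIV) \<longlonglongrightarrow> 1"
    unfolding density_at_def
    \<comment> \<open>The density at 0 is \<open>0 / 0 = 0\<close>, so the value 1 is attained only
      from \<open>n = 1\<close> on.\<close>
    by (rule tendsto_eventually) (auto intro!: eventually_sequentiallyI[of 1])
  ultimately show False
    using LIMSEQ_unique by fastforce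
qed

lemma card_pairs_at_le:
  assumes "strict_mono a"
  shows "card (pairs_at (range a) \<inter> {..<2 * a j}) \<le> 2 * j"
proof -
  \<comment> \<open>Counting from 0, the \<open>k\<close>-th element of the set is
    \<open>2 * a (k div 2) + k mod 2\<close>.\<close>
  have "pairs_at (range a) \<inter> {..<2 * a j} \<subseteq> (\<lambda>k. 2 * a (k div 2) + k mod 2) ` {..<2 * j}"
  proof
    fix x
    assume x: "x \<in> pairs_at (range a) \<inter> {..<2 * a j}"
    then obtain i where i: "x div 2 = a i"
      by (auto simp: pairs_at_def)
    with x have "a i < a j" by auto
    then have "i < j"
      using assms by (simp add: strict_mono_less)
    then show "x \<in> (\<lambda>k. 2 * a (k div 2) + k mod 2) ` {..<2 * j}"
      using i mult_div_mod_eq[of 2 x] by (intro image_eqI[of _ _ "2 * i + x mod 2"]) simp_all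
  qed
  then have "card (pairs_at (range a) \<inter> {..<2 * a j}) \<le>
      card ((\<lambda>k. 2 * a (k div 2) + k mod 2) ` {..<2 * j})"
    by (intro card_mono) auto
  also have "\<dots> \<le> 2 * j"
    using card_image_le[of "{..<2 * j}"] by fastforce
  finally show ?thesis .
qed

section \<open>Skip rules\<close>

text \<open>Each step appends a position determined by the history and one of two bits, so the
  number of histories at most doubles.\<close>

lemma finite_range_skip_history: "finite (range (\<lambda>B. skip_history f B n))"
proof (induction n)
  case (Suc n)
  have "range (\<lambda>B. skip_history f B (Suc n)) \<subseteq>
      (\<lambda>(\<sigma>, b). \<sigma> @ [(f \<sigma>, b)]) ` (range (\<lambda>B. skip_history f B n) \<times> UNIV)"
    by auto
  then show ?case
    using Suc.IH by (meson finite_SigmaI finite_UNIV finite_imageI finite_subset)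
qed simp

text \<open>The maximum over all sets \<open>B\<close> makes the bound independent of the set that
  is later built from it.\<close>

definition position_bound :: "((nat \<times> bool) list \<Rightarrow> nat) \<Rightarrow> nat \<Rightarrow> nat" where
  "position_bound f n = Max (f ` range (\<lambda>B. skip_history f B n))"

lemma le_position_bound: "f (skip_history f B n) \<le> position_bound f n"
  unfolding position_bound_def by (rule Max_ge) (auto simp: finite_range_skip_history)

text \<open>Histories of \<open>f\<close> stay inside \<open>skip_sequences\<close>, so a program
  that is correct only there reproduces them.\<close>

lemma skip_history_cong:
  assumes "skip_rule f" "\<And>\<sigma>. \<sigma> \<in> skip_sequences \<Longrightarrow> g \<sigma> = f \<sigma>"
  shows "skip_history g A n = skip_history f A n"
  by (induction n) (simp_all add: assms skip_history_in_skip_sequences)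

lemma strict_mono_skip_position:
  assumes "skip_rule f"
  shows "strict_mono (\<lambda>n. f (skip_history f A n))"
unfolding strict_mono_Suc_iff
proof
  fix n
  have "fst (last (skip_history f A (Suc n))) < f (skip_history f A (Suc n))"
    using assms skip_history_in_skip_sequences[OF assms, of A "Suc n"]
    unfolding skip_rule_def by (metis append_is_Nil_conv list.distinct(1) skip_history.simps(2))
  then show "f (skip_history f A n) < f (skip_history f A (Suc n))"
    by simp
qed

text \<open>Steps before \<open>n\<close> examine distinct positions strictly below the one of step
  \<open>n\<close>, so ones found in different steps are different elements of
  \<open>A\<close>.\<close>

lemma card_skip_select_le:
  assumes "skip_rule f" "f (skip_history f A n) \<le> m"
  shows "card (skip_select f A \<inter> {..<n}) \<le> card (A \<inter> {..<m})"
proof (rule card_inj_on_le)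
  note mono = strict_mono_skip_position[OF assms(1), of A]
  show "inj_on (\<lambda>n. f (skip_history f A n)) (skip_select f A \<inter> {..<n})"
    using strict_mono_imp_inj_on[OF mono] by (rule inj_on_subset) (rule subset_UNIV)
  show "(\<lambda>n. f (skip_history f A n)) ` (skip_select f A \<inter> {..<n}) \<subseteq> A \<inter> {..<m}"
    using strict_monoD[OF mono] assms(2) by (fastforce simp: skip_select_def)
qed simp

text \<open>Rounding \<open>sqrt n\<close> up to \<open>j\<close> gives
  \<open>n \<le> j ^ 2\<close>, so a prefix of length \<open>n\<close> contains at most
  \<open>2 * (sqrt n + 1)\<close> elements.\<close>

lemma has_density_0_if_card_squares:
  assumes "\<And>j. j \<ge> i \<Longrightarrow> card (B \<inter> {..<j ^ 2}) \<le> 2 * j"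
  shows "has_density B 0"
  unfolding has_density_def
proof (rule tendsto_sandwich)
  show "\<forall>\<^sub>F n in sequentially. 0 \<le> density_at n B"
    by (simp add: density_at_def)
  show "\<forall>\<^sub>F n in sequentially. density_at n B \<le> 2 * (sqrt (real n) + 1) / real n"
  proof (rule eventually_sequentiallyI[of "i ^ 2"])
    fix n
    assume n: "i ^ 2 \<le> n"
    define j where "j = nat \<lceil>sqrt (real n)\<rceil>"
    have j: "sqrt (real n) \<le> real j" "real j \<le> sqrt (real n) + 1"
      by (simp_all add: j_def)
    have "real i \<le> sqrt (real n)"
      using n by (intro real_le_rsqrt) (metis of_nat_le_iff of_nat_power)
    with j have "i \<le> j" by linarith
    have "real n \<le> real j ^ 2"
      using j(1) by (rule sqrt_le_D)
    then have "n \<le> j ^ 2"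
      by (metis of_nat_le_iff of_nat_power)
    then have "card (B \<inter> {..<n}) \<le> card (B \<inter> {..<j ^ 2})"
      by (intro card_mono) auto
    also have "\<dots> \<le> 2 * j"
      using assms \<open>i \<le> j\<close> by blast
    finally have "real (card (B \<inter> {..<n})) \<le> 2 * real j"
      by linarith
    then have "real (card (B \<inter> {..<n})) \<le> 2 * (sqrt (real n) + 1)"
      using j(2) by argo
    then show "density_at n B \<le> 2 * (sqrt (real n) + 1) / real n"
      unfolding density_at_def by (rule divide_right_mono) simp
  qed
  show "(\<lambda>n. 2 * (sqrt (real n) + 1) / real n) \<longlonglongrightarrow> 0"
    by real_asymp
qed simp

section \<open>Dominating all programs at once, and the conclusion\<close>

lemma ex_strict_mono_dominating:
  fixes h :: "nat \<Rightarrow> nat \<Rightarrow> nat"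
  obtains a where "strict_mono a" "\<And>i j. i \<le> j \<Longrightarrow> h i j \<le> a j"
proof
  \<comment> \<open>The inner sum bounds the functions with index at most \<open>k\<close> at the
    point \<open>k\<close>; the outer sum adds these positive terms up, giving strict
    growth.\<close>
  let ?a = "\<lambda>j. \<Sum>k\<le>j. \<Sum>i\<le>k. Suc (h i k)"
  show "strict_mono ?a"
    by (simp add: strict_mono_Suc_iff)
  fix i j :: nat
  assume "i \<le> j"
  then have "Suc (h i j) \<le> (\<Sum>i\<le>j. Suc (h i j))"
    by (intro member_le_sum) auto
  also have "\<dots> \<le> ?a j"
    by (rule member_le_sum[of j]) auto
  finally show "h i j \<le> ?a j" by simp
qed

instance recf :: countable
  by countable_datatype

theorem theorem2: "\<exists>A :: nat set. weakly_stochastic 0 A \<and> \<not> church_stochastic 0 A"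
proof -
  \<comment> \<open>This lists all programs, total or not. Where one diverges, \<open>the\<close>
    supplies some value, and \<open>position_bound\<close> needs no skip rule.\<close>
  define rule where "rule i \<sigma> = the (recf_eval (from_nat i) [skip_code \<sigma>])" for i \<sigma>
  obtain a :: "nat \<Rightarrow> nat" where a: "strict_mono a"
    and dom: "\<And>i j. i \<le> j \<Longrightarrow> position_bound (rule i) (j ^ 2) \<le> a j"
    using ex_strict_mono_dominating[of "\<lambda>i j. position_bound (rule i) (j ^ 2)"] by blast
  let ?A = "pairs_at (range a)"
  have "has_density (skip_select f ?A) 0"
    if f: "skip_rule f" and comp: "computable_on skip_code skip_sequences f" for f
  proof -
    obtain r where r: "\<And>\<sigma>. \<sigma> \<in> skip_sequences \<Longrightarrow> recf_eval r [skip_code \<sigma>] = Some (f \<sigma>)"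
      using comp by (auto simp: computable_on_def)
    \<comment> \<open>The index of the program is also the threshold from which \<open>a\<close>
      dominates its bounds.\<close>
    define i where "i = to_nat r"
    have eq: "rule i \<sigma> = f \<sigma>" if "\<sigma> \<in> skip_sequences" for \<sigma>
      using that by (simp add: rule_def i_def r)
    show ?thesis
    proof (rule has_density_0_if_card_squares)
      fix j
      assume "i \<le> j"
      have "f (skip_history f ?A (j ^ 2)) = rule i (skip_history (rule i) ?A (j ^ 2))"
        using f by (simp add: skip_history_cong[OF f eq] eq skip_history_in_skip_sequences)
      also have "\<dots> \<le> position_bound (rule i) (j ^ 2)"
        by (rule le_position_bound)
      \<comment> \<open>The pair with index \<open>j\<close> starts at \<open>2 * a j\<close>, so
        only the \<open>j\<close> earlier pairs lie below.\<close>
      also have "\<dots> \<le> 2 * a j"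
        using dom[OF \<open>i \<le> j\<close>] by simp
      finally show "card (skip_select f ?A \<inter> {..<j ^ 2}) \<le> 2 * j"
        using card_skip_select_le[OF f] card_pairs_at_le[OF a, of j] le_trans by blast
    qed
  qed
  then have "weakly_stochastic 0 ?A"
    by (simp add: weakly_stochastic_def)
  moreover have "\<not> church_stochastic 0 ?A"
    using a by (intro pairs_at_not_church_stochastic)
      (simp add: range_inj_infinite strict_mono_imp_inj_on)
  ultimately show ?thesis by blast
qed

end
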